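(* Let $f\colon\mathcal H\to\mathbb R$ be Fréchet differentiable and $L_f$-smooth for some $L_f>0$, let $(C_i)_{i\in I}$ be a collection of nonempty compact convex subsets of $\mathcal H$ such that $\bigcap_{i\in I}C_i\ne\varnothing$, and let $\boldsymbol D$ denote the diagonal subspace of $\boldsymbol{\mathcal H}$. Suppose that $(\lambda_t)_{t\in\mathbb N}$ is a sequence of real numbers with $\lambda_t\to+\infty$ and, for every $t\in\mathbb N$, set $\boldsymbol f_t=f\circ A+\frac{\lambda_t}{2}\operatorname{dist}_{\boldsymbol D}^2+\iota_{\prod_{i\in I}C_i}$. Then the following hold. (i) $\boldsymbol f_t$ converges pointwise to $f\circ A+\iota_{\boldsymbol D\cap\prod_{i\in I}C_i}$. (ii) Suppose $\mathcal H=\mathbb R^n$. Then $\boldsymbol f_t$ converges epigraphically to $f\circ A+\iota_{\boldsymbol D\cap\prod_{i\in I}C_i}$. (iii) Suppose $\mathcal H=\mathbb R^n$ and $f$ is convex. Then $\partial\boldsymbol f_t$ converges graphically to $\partial\bigl(f\circ A+\iota_{\boldsymbol D\cap\prod_{i\in I}C_i}\bigr)$.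
   Context: $\mathcal H$ is a real Hilbert space with inner product $\langle\cdot\mid\cdot\rangle$ and norm $\|\cdot\|$. $m\ge1$ is an integer, $I=\{1,\dots,m\}$, and $\{\omega_i\}_{i\in I}\subset\left]0,1\right]$ satisfies $\sum_{i\in I}\omega_i=1$. $\boldsymbol{\mathcal H}=\mathcal H^m$ is the real Hilbert space with inner product $\langle\boldsymbol x\mid\boldsymbol y\rangle_{\boldsymbol{\mathcal H}}=\sum_{i\in I}\omega_i\langle\boldsymbol x^i\mid\boldsymbol y^i\rangle$, where $\boldsymbol x=(\boldsymbol x^1,\dots,\boldsymbol x^m)$. $\boldsymbol D=\{\boldsymbol x\in\boldsymbol{\mathcal H}:\boldsymbol x^1=\dots=\boldsymbol x^m\}$, and $\operatorname{dist}_{\boldsymbol D}(\boldsymbol x)=\inf_{\boldsymbol z\in\boldsymbol D}\|\boldsymbol x-\boldsymbol z\|_{\boldsymbol{\mathcal H}}$. $A\colon\boldsymbol{\mathcal H}\to\mathcal H\colon\boldsymbol x\mapsto\sum_{i\in I}\omega_i\boldsymbol x^i$. $\prod_{i\in I}C_i=C_1\times\dots\times C_m\subset\boldsymbol{\mathcal H}$. For a set $S$, $\iota_S$ equals $0$ on $S$ and $+\infty$ off $S$. $f$ is $L_f$-smooth if $f(y)-f(x)\le\langle\nabla f(x)\mid y-x\rangle+\frac{L_f}{2}\|y-x\|^2$ for all $x,y\in\mathcal H$. For a function $h$ on a Hilbert space $\mathcal K$ with values in $\left]-\infty,+\infty\right]$: $\partial h(x)=\{u\in\mathcal K:(\forall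 y\in\mathcal K)\ h(x)+\langle u\mid y-x\rangle\le h(y)\}$; $\operatorname{epi}h=\{(x,\eta)\in\mathcal K\times\mathbb R:h(x)\le\eta\}$; and the graph of a set-valued operator $M\colon\mathcal K\to2^{\mathcal K}$ is $\operatorname{gra}M=\{(x,u)\in\mathcal K^2:u\in M(x)\}$. A sequence $(S_t)_{t\in\mathbb N}$ of subsets of a finite-dimensional space converges to $S$ if its outer limit $\{x:\liminf_{t\to\infty}\operatorname{dist}_{S_t}(x)=0\}$ and its inner limit $\{x:\limsup_{t\to\infty}\operatorname{dist}_{S_t}(x)=0\}$ both equal $S$ (Painlevé–Kuratowski convergence). Functions $h_t$ converge epigraphically to $h$ if $\operatorname{epi}h_t$ converges to $\operatorname{epi}h$; $\partial h_t$ converges graphically to $\partial h$ if $\operatorname{gra}\partial h_t$ converges to $\operatorname{gra}\partial h$. *)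

theory Defs
  imports "HOL-Analysis.Analysis"
begin

(* By the Riesz representation theorem the gradient exists and is unique wherever f is
   Frechet differentiable; GDERIV f x :> D says that f has Frechet derivative h |-> <h | D>. *)
definition gradient :: "('a::real_inner \<Rightarrow> real) \<Rightarrow> 'a \<Rightarrow> 'a"
  where "gradient f x = (THE D. GDERIV f x :> D)"

lemma gradient_eq:
  assumes "GDERIV f x :> D"
  shows "gradient f x = D"
  unfolding gradient_def
proof (rule the_equality)
  fix D' assume "GDERIV f x :> D'"
  with assms have "(\<lambda>h. h \<bullet> D') = (\<lambda>h. h \<bullet> D)"
    unfolding gderiv_def by (rule has_derivative_unique[rotated])
  then have "(D' - D) \<bullet> (D' - D) = 0"
    by (simp add: fun_eq_iff inner_diff_right)
  then show "D' = D" by simp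
qed (fact assms)

definition L_smooth :: "real \<Rightarrow> ('a::real_inner \<Rightarrow> real) \<Rightarrow> bool"
  where "L_smooth L f \<longleftrightarrow>
    (\<forall>x y. f y - f x \<le> gradient f x \<bullet> (y - x) + L / 2 * (norm (y - x))\<^sup>2)"

(* The product space H^m, with m = CARD('m), is carried by 'a ^ 'm, but only the vector space
   structure of that type is used: its library norm and inner product are unweighted, and the
   weighted ones are the following. *)
definition winner :: "('m::finite \<Rightarrow> real) \<Rightarrow> 'a::real_inner ^ 'm \<Rightarrow> 'a ^ 'm \<Rightarrow> real"
  where "winner \<omega> x y = (\<Sum>i\<in>UNIV. \<omega> i * (x $ i \<bullet> y $ i))"

definition wnorm :: "('m::finite \<Rightarrow> real) \<Rightarrow> 'a::real_inner ^ 'm \<Rightarrow> real"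
  where "wnorm \<omega> x = sqrt (winner \<omega> x x)"

definition diagonal :: "('a ^ 'm) set"
  where "diagonal = {x. \<forall>i j. x $ i = x $ j}"

definition dist_diagonal :: "('m::finite \<Rightarrow> real) \<Rightarrow> 'a::real_inner ^ 'm \<Rightarrow> real"
  where "dist_diagonal \<omega> x = (INF z\<in>diagonal. wnorm \<omega> (x - z))"

definition averaging :: "('m::finite \<Rightarrow> real) \<Rightarrow> 'a::real_inner ^ 'm \<Rightarrow> 'a"
  where "averaging \<omega> x = (\<Sum>i\<in>UNIV. \<omega> i *\<^sub>R (x $ i))"

definition set_product :: "('m \<Rightarrow> 'a set) \<Rightarrow> ('a ^ 'm) set"
  where "set_product C = {x. \<forall>i. x $ i \<in> C i}"

definition iota :: "'k set \<Rightarrow> 'k \<Rightarrow> ereal"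
  where "iota S x = (if x \<in> S then 0 else \<infinity>)"

definition penalized ::
  "('m::finite \<Rightarrow> real) \<Rightarrow> ('a::real_inner \<Rightarrow> real) \<Rightarrow> ('m \<Rightarrow> 'a set) \<Rightarrow> real \<Rightarrow> 'a ^ 'm \<Rightarrow> ereal"
  where "penalized \<omega> f C l x =
    ereal (f (averaging \<omega> x)) + ereal (l / 2 * (dist_diagonal \<omega> x)\<^sup>2) + iota (set_product C) x"

definition constrained ::
  "('m::finite \<Rightarrow> real) \<Rightarrow> ('a::real_inner \<Rightarrow> real) \<Rightarrow> ('m \<Rightarrow> 'a set) \<Rightarrow> 'a ^ 'm \<Rightarrow> ereal"
  where "constrained \<omega> f C x =
    ereal (f (averaging \<omega> x)) + iota (diagonal \<inter> set_product C) x"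

(* Below, the Hilbert space structure of the space 'k is an explicit argument (an inner product ip
   or a norm N), to be instantiated with winner \<omega> and wnorm \<omega>. *)
definition subdifferential ::
  "('k::real_vector \<Rightarrow> 'k \<Rightarrow> real) \<Rightarrow> ('k \<Rightarrow> ereal) \<Rightarrow> 'k \<Rightarrow> 'k set"
  where "subdifferential ip h x = {u. \<forall>y. h x + ereal (ip u (y - x)) \<le> h y}"

definition epi :: "('k \<Rightarrow> ereal) \<Rightarrow> ('k \<times> real) set"
  where "epi h = {(x, \<eta>). h x \<le> ereal \<eta>}"

definition gra :: "('k \<Rightarrow> 'k set) \<Rightarrow> ('k \<times> 'k) set"
  where "gra M = {(x, u). u \<in> M x}"

definition prod_norm ::
  "('k \<Rightarrow> real) \<Rightarrow> ('l \<Rightarrow> real) \<Rightarrow> 'k \<times> 'l \<Rightarrow> real"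
  where "prod_norm N N' p = sqrt ((N (fst p))\<^sup>2 + (N' (snd p))\<^sup>2)"

(* Extended-real valued, so that the distance to the empty set is \<infinity>. *)
definition dist_set :: "('k::real_vector \<Rightarrow> real) \<Rightarrow> 'k set \<Rightarrow> 'k \<Rightarrow> ereal"
  where "dist_set N S x = (INF z\<in>S. ereal (N (x - z)))"

definition outer_limit :: "('k::real_vector \<Rightarrow> real) \<Rightarrow> (nat \<Rightarrow> 'k set) \<Rightarrow> 'k set"
  where "outer_limit N S = {x. liminf (\<lambda>t. dist_set N (S t) x) = 0}"

definition inner_limit :: "('k::real_vector \<Rightarrow> real) \<Rightarrow> (nat \<Rightarrow> 'k set) \<Rightarrow> 'k set"
  where "inner_limit N S = {x. limsup (\<lambda>t. dist_set N (S t) x) = 0}"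

definition PK_converges :: "('k::real_vector \<Rightarrow> real) \<Rightarrow> (nat \<Rightarrow> 'k set) \<Rightarrow> 'k set \<Rightarrow> bool"
  where "PK_converges N S T \<longleftrightarrow> outer_limit N S = T \<and> inner_limit N S = T"

definition epi_converges ::
  "('k::real_vector \<Rightarrow> real) \<Rightarrow> (nat \<Rightarrow> 'k \<Rightarrow> ereal) \<Rightarrow> ('k \<Rightarrow> ereal) \<Rightarrow> bool"
  where "epi_converges N h h' \<longleftrightarrow> PK_converges (prod_norm N norm) (\<lambda>t. epi (h t)) (epi h')"

definition graph_converges ::
  "('k::real_vector \<Rightarrow> real) \<Rightarrow> (nat \<Rightarrow> 'k \<Rightarrow> 'k set) \<Rightarrow> ('k \<Rightarrow> 'k set) \<Rightarrow> bool"
  where "graph_converges N M M' \<longleftrightarrow> PK_converges (prod_norm N N) (\<lambda>t. gra (M t)) (gra M')"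

(* H = R^n up to the choice of an orthonormal basis, n being arbitrary. *)
definition finite_dim :: "'a::real_vector itself \<Rightarrow> bool"
  where "finite_dim TYPE('a) \<longleftrightarrow> (\<exists>B::'a set. finite B \<and> span B = UNIV)"

end

theory Submission
  imports Defs
begin

text \<open>
  Write \<open>K\<close> for the product of the sets \<open>C i\<close> and \<open>D\<close> for the diagonal. The penalized functions
  agree with the constrained one on \<open>D \<inter> K\<close> and never exceed it, so everything hinges on what
  happens along sequences that approach a point through \<open>K - D\<close>. This is answered once and for
  all by \<open>limit_of_bounded_penalties\<close>: if \<open>x k\<close> in \<open>K\<close> tends to \<open>a\<close> and the penalized values at
  \<open>x k\<close>, with parameters tending to infinity, are bounded by a convergent sequence, then the
  squared distances to \<open>D\<close> are at most of the order of the inverse parameters, whence \<open>a\<close> lies in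
  \<open>D \<inter> K\<close>; and the value at \<open>a\<close> is at most the limit of the bounds because the penalty term is
  eventually nonnegative.

  Read on epigraphs, this lemma gives the outer limit inclusion for epigraphical convergence; the
  inner one holds because the epigraph of the constrained function is contained in all the others.
  Read on the subgradient inequality tested at points of \<open>D \<inter> K\<close>, it shows that limits of
  subgradients of the penalized functions are subgradients of the constrained function
  (\<open>limit_of_subgradients\<close>).

  The remaining inclusion must produce, for a subgradient \<open>u\<close> of the constrained function at \<open>a\<close>,
  nearby subgradients of the penalized functions. As in Attouch's theorem they come from proximal
  points: \<open>p t\<close> minimizes the penalized function plus half the squared distance to \<open>a + u\<close>.
  A minimizer exists since \<open>K\<close> is compact, and by convexity \<open>a + u - p t\<close> is a subgradient at
  \<open>p t\<close> (\<open>proximal_optimality\<close>). At any cluster point \<open>b\<close> of \<open>p\<close> the previous paragraph makes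
  \<open>a + u - b\<close> a subgradient of the constrained function, and monotonicity of the subdifferential,
  applied to the pairs \<open>(a, u)\<close> and \<open>(b, a + u - b)\<close>, forces \<open>b = a\<close>. Hence \<open>p t\<close> tends to \<open>a\<close>
  and the subgradients \<open>a + u - p t\<close> tend to \<open>u\<close>.
\<close>

section \<open>Sequential criterion for Painleve--Kuratowski convergence\<close>

text \<open>
  The inner limit is always contained in the outer one, so it suffices to place \<open>T\<close> inside the
  inner limit and the outer limit inside \<open>T\<close>. Outer limit points are limits of points of
  \<open>S (r k)\<close>, where it suffices to pick each \<open>r k\<close> beyond \<open>k\<close>.
\<close>

lemma PK_convergesI:
  fixes N :: "'k::real_vector \<Rightarrow> real"
  assumes nonneg: "\<And>x. 0 \<le> N x"
    and inner: "\<And>x. x \<in> T \<Longrightarrow>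
      \<exists>q. (\<forall>\<^sub>F t in sequentially. q t \<in> S t) \<and> (\<lambda>t. N (x - q t)) \<longlonglongrightarrow> 0"
    and outer: "\<And>x r q. filterlim r at_top sequentially \<Longrightarrow> (\<And>k. q k \<in> S (r k)) \<Longrightarrow>
      (\<lambda>k. N (x - q k)) \<longlonglongrightarrow> 0 \<Longrightarrow> x \<in> T"
  shows "PK_converges N S T"
proof -
  have dist_nonneg: "0 \<le> dist_set N (S t) x" for t x
    unfolding dist_set_def by (rule INF_greatest) (simp add: nonneg)
  have "T \<subseteq> inner_limit N S"
  proof
    fix x assume "x \<in> T"
    then obtain q where q: "\<forall>\<^sub>F t in sequentially. q t \<in> S t" "(\<lambda>t. N (x - q t)) \<longlonglongrightarrow> 0"
      using inner by blast
    have "limsup (\<lambda>t. dist_set N (S t) x) \<le> limsup (\<lambda>t. ereal (N (x - q t)))"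
      unfolding dist_set_def by (intro Limsup_mono eventually_mono[OF q(1)] INF_lower)
    also have "\<dots> = 0"
      using q(2) by (intro lim_imp_Limsup) (simp_all add: zero_ereal_def)
    finally have "limsup (\<lambda>t. dist_set N (S t) x) = 0"
    proof (rule order_antisym)
      show "0 \<le> limsup (\<lambda>t. dist_set N (S t) x)"
        by (rule le_Limsup) (simp_all add: dist_nonneg)
    qed
    then show "x \<in> inner_limit N S"
      by (simp add: inner_limit_def)
  qed
  moreover have "inner_limit N S \<subseteq> outer_limit N S"
  proof
    fix x assume "x \<in> inner_limit N S"
    then have "limsup (\<lambda>t. dist_set N (S t) x) = 0"
      by (simp add: inner_limit_def)
    moreover have "liminf (\<lambda>t. dist_set N (S t) x) \<le> limsup (\<lambda>t. dist_set N (S t) x)"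
      by (rule Liminf_le_Limsup) simp
    moreover have "0 \<le> liminf (\<lambda>t. dist_set N (S t) x)"
      by (rule Liminf_bounded) (simp add: dist_nonneg)
    ultimately show "x \<in> outer_limit N S"
      by (simp add: outer_limit_def)
  qed
  moreover have "outer_limit N S \<subseteq> T"
  proof
    fix x assume "x \<in> outer_limit N S"
    then have lim: "liminf (\<lambda>t. dist_set N (S t) x) = 0"
      by (simp add: outer_limit_def)
    \<comment> \<open>Were the distances at least \<open>1 / (k + 1)\<close> from index \<open>k\<close> on, so would be their lower limit.\<close>
    have "\<exists>t z. k \<le> t \<and> z \<in> S t \<and> N (x - z) < inverse (real (Suc k))" for k
    proof (rule ccontr)
      assume *: "\<nexists>t z. k \<le> t \<and> z \<in> S t \<and> N (x - z) < inverse (real (Suc k))"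
      have "ereal (inverse (real (Suc k))) \<le> dist_set N (S t) x" if "k \<le> t" for t
        unfolding dist_set_def using * that by (intro INF_greatest) (auto simp: not_less)
      then have "ereal (inverse (real (Suc k))) \<le> liminf (\<lambda>t. dist_set N (S t) x)"
        by (intro Liminf_bounded) (auto simp: eventually_sequentially)
      with lim show False by (simp flip: zero_ereal_def)
    qed
    then obtain r q where rq: "\<And>k. k \<le> r k" "\<And>k. q k \<in> S (r k)"
      "\<And>k. N (x - q k) < inverse (real (Suc k))"
      by metis
    have "(\<lambda>k. N (x - q k)) \<longlonglongrightarrow> 0"
      by (intro tendsto_sandwich[OF _ _ tendsto_const LIMSEQ_inverse_real_of_nat]
          always_eventually allI nonneg less_imp_le[OF rq(3)])
    moreover have "filterlim r at_top sequentially"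
      using rq(1) by (intro filterlim_at_top_mono[OF filterlim_ident]) auto
    ultimately show "x \<in> T"
      using outer rq(2) by blast
  qed
  ultimately show ?thesis
    unfolding PK_converges_def by blast
qed

lemma prod_norm_nonneg: "0 \<le> prod_norm N N' p"
  by (simp add: prod_norm_def)

lemma tendsto_prod_normI:
  assumes "(\<lambda>k. N (fst (p k))) \<longlonglongrightarrow> 0" "(\<lambda>k. N' (snd (p k))) \<longlonglongrightarrow> 0"
  shows "(\<lambda>k. prod_norm N N' (p k)) \<longlonglongrightarrow> 0"
proof -
  have "(\<lambda>k. sqrt ((N (fst (p k)))\<^sup>2 + (N' (snd (p k)))\<^sup>2)) \<longlonglongrightarrow> sqrt (0\<^sup>2 + 0\<^sup>2)"
    by (intro tendsto_intros assms)
  then show ?thesis by (simp add: prod_norm_def)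
qed

lemma tendsto_prod_normD:
  assumes lim: "(\<lambda>k. prod_norm N N' (p k)) \<longlonglongrightarrow> 0"
  shows "(\<lambda>k. N (fst (p k))) \<longlonglongrightarrow> 0" "(\<lambda>k. N' (snd (p k))) \<longlonglongrightarrow> 0"
proof -
  have "\<bar>N (fst (p k))\<bar> \<le> prod_norm N N' (p k)" "\<bar>N' (snd (p k))\<bar> \<le> prod_norm N N' (p k)" for k
    unfolding prod_norm_def by (rule real_le_rsqrt, simp)+
  then show "(\<lambda>k. N (fst (p k))) \<longlonglongrightarrow> 0" "(\<lambda>k. N' (snd (p k))) \<longlonglongrightarrow> 0"
    by (auto intro!: Lim_null_comparison[OF _ lim])
qed


section \<open>The weighted product space\<close>

locale weighted_product =
  fixes \<omega> :: "'m::finite \<Rightarrow> real"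
  assumes weight_pos: "0 < \<omega> i"
    and weights_sum: "(\<Sum>i\<in>UNIV. \<omega> i) = 1"
begin

lemma weight_nonneg: "0 \<le> \<omega> i"
  using weight_pos[of i] by simp

lemma winner_nonneg: "0 \<le> winner \<omega> x x"
  by (simp add: winner_def sum_nonneg weight_nonneg)

lemma wnorm_nonneg: "0 \<le> wnorm \<omega> x"
  by (simp add: wnorm_def winner_nonneg)

lemma wnorm_power2: "(wnorm \<omega> x)\<^sup>2 = winner \<omega> x x"
  by (simp add: wnorm_def winner_nonneg)

lemma winner_add_left: "winner \<omega> (x + y) z = winner \<omega> x z + winner \<omega> y z"
  and winner_add_right: "winner \<omega> z (x + y) = winner \<omega> z x + winner \<omega> z y"
  and winner_diff_left: "winner \<omega> (x - y) z = winner \<omega> x z - winner \<omega> y z"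
  and winner_diff_right: "winner \<omega> z (x - y) = winner \<omega> z x - winner \<omega> z y"
  by (simp_all add: winner_def inner_simps algebra_simps sum.distrib sum_subtractf)

lemma winner_scaleR_left: "winner \<omega> (a *\<^sub>R x) z = a * winner \<omega> x z"
  and winner_scaleR_right: "winner \<omega> z (a *\<^sub>R x) = a * winner \<omega> z x"
  by (simp_all add: winner_def sum_distrib_left algebra_simps)

lemma winner_commute: "winner \<omega> x y = winner \<omega> y x"
  by (simp add: winner_def inner_commute)

lemmas winner_simps = winner_add_left winner_add_right winner_diff_left winner_diff_right
  winner_scaleR_left winner_scaleR_right

lemma norm_component_le: "norm (x $ i) \<le> wnorm \<omega> x / sqrt (\<omega> i)"
proof -
  have "\<omega> i * (norm (x $ i))\<^sup>2 \<le> (wnorm \<omega> x)\<^sup>2"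
    unfolding wnorm_power2 winner_def power2_norm_eq_inner
    by (rule member_le_sum[of i UNIV "\<lambda>i. \<omega> i * (x $ i \<bullet> x $ i)"]) (simp_all add: weight_nonneg)
  then have "(norm (x $ i) * sqrt (\<omega> i))\<^sup>2 \<le> (wnorm \<omega> x)\<^sup>2"
    by (simp add: power_mult_distrib weight_nonneg mult.commute)
  then have "norm (x $ i) * sqrt (\<omega> i) \<le> wnorm \<omega> x"
    by (rule power2_le_imp_le) (rule wnorm_nonneg)
  then show ?thesis by (simp add: weight_pos pos_le_divide_eq)
qed

lemma wnorm_eq_0_iff: "wnorm \<omega> x = 0 \<longleftrightarrow> x = 0"
proof
  assume "wnorm \<omega> x = 0"
  then have "norm (x $ i) \<le> 0" for i
    using norm_component_le[of x i] by simp
  then show "x = 0" by (simp add: vec_eq_iff)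
qed (simp add: wnorm_def winner_def)

lemma tendsto_winner:
  "(x \<longlongrightarrow> a) F \<Longrightarrow> (y \<longlongrightarrow> b) F \<Longrightarrow> ((\<lambda>k. winner \<omega> (x k) (y k)) \<longlongrightarrow> winner \<omega> a b) F"
  unfolding winner_def by (intro tendsto_intros)

lemma tendsto_wnorm: "(x \<longlongrightarrow> a) F \<Longrightarrow> ((\<lambda>k. wnorm \<omega> (x k)) \<longlongrightarrow> wnorm \<omega> a) F"
  unfolding wnorm_def by (intro tendsto_intros tendsto_winner)

text \<open>
  As all weights are positive, the weighted norm induces the product topology. Limits in the
  Painleve--Kuratowski sense can thus be handled with the usual limit rules for vectors.
\<close>

lemma tendsto_iff_wnorm: "x \<longlonglongrightarrow> a \<longleftrightarrow> (\<lambda>k. wnorm \<omega> (a - x k)) \<longlonglongrightarrow> 0"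
proof
  assume lim: "(\<lambda>k. wnorm \<omega> (a - x k)) \<longlonglongrightarrow> 0"
  show "x \<longlonglongrightarrow> a"
  proof (rule vec_tendstoI)
    fix i
    have "(\<lambda>k. wnorm \<omega> (a - x k) / sqrt (\<omega> i)) \<longlonglongrightarrow> 0"
      using tendsto_divide[OF lim tendsto_const, of "sqrt (\<omega> i)"] weight_pos[of i] by simp
    then have "(\<lambda>k. a $ i - x k $ i) \<longlonglongrightarrow> 0"
      by (rule Lim_null_comparison[rotated]) (use norm_component_le[of "a - x _" i] in simp)
    then show "(\<lambda>k. x k $ i) \<longlonglongrightarrow> a $ i"
      using tendsto_diff[OF tendsto_const[of "a $ i"], of "\<lambda>k. a $ i - x k $ i" 0] by simp
  qed
next
  assume "x \<longlonglongrightarrow> a"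
  then have "(\<lambda>k. wnorm \<omega> (a - x k)) \<longlonglongrightarrow> wnorm \<omega> (a - a)"
    by (intro tendsto_wnorm tendsto_intros)
  then show "(\<lambda>k. wnorm \<omega> (a - x k)) \<longlonglongrightarrow> 0"
    by (simp add: wnorm_def winner_def)
qed

text \<open>The defect in this convexity inequality is \<open>s (1 - s)\<close> times the squared norm of \<open>x - y\<close>.\<close>

lemma wnorm_power2_convex:
  assumes "0 \<le> s" "s \<le> 1"
  shows "(wnorm \<omega> ((1 - s) *\<^sub>R x + s *\<^sub>R y))\<^sup>2 \<le> (1 - s) * (wnorm \<omega> x)\<^sup>2 + s * (wnorm \<omega> y)\<^sup>2"
proof -
  have "(1 - s) * (wnorm \<omega> x)\<^sup>2 + s * (wnorm \<omega> y)\<^sup>2 - (wnorm \<omega> ((1 - s) *\<^sub>R x + s *\<^sub>R y))\<^sup>2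
    = (1 - s) * s * (wnorm \<omega> (x - y))\<^sup>2"
    unfolding wnorm_power2 winner_simps winner_commute[of y x] by algebra
  moreover have "0 \<le> (1 - s) * s * (wnorm \<omega> (x - y))\<^sup>2"
    using assms by simp
  ultimately show ?thesis by linarith
qed

lemma tendsto_averaging: "(x \<longlongrightarrow> a) F \<Longrightarrow> ((\<lambda>k. averaging \<omega> (x k)) \<longlongrightarrow> averaging \<omega> a) F"
  unfolding averaging_def by (intro tendsto_intros)

lemma averaging_combination:
  "averaging \<omega> (a *\<^sub>R x + b *\<^sub>R y) = a *\<^sub>R averaging \<omega> x + b *\<^sub>R averaging \<omega> y"
  by (simp add: averaging_def scaleR_right_distrib sum.distrib scaleR_sum_right algebra_simps)

text \<open>This is the orthogonal projection onto the orthogonal complement of the diagonal.\<close>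

definition deviation :: "'a::real_inner ^ 'm \<Rightarrow> 'a ^ 'm"
  where "deviation x = (\<chi> i. x $ i - averaging \<omega> x)"

lemma deviation_combination: "deviation (a *\<^sub>R x + b *\<^sub>R y) = a *\<^sub>R deviation x + b *\<^sub>R deviation y"
  by (simp add: vec_eq_iff deviation_def averaging_combination algebra_simps)

lemma deviation_eq_0_iff: "deviation x = 0 \<longleftrightarrow> x \<in> diagonal"
proof
  assume "x \<in> diagonal"
  then obtain c where "\<And>i. x $ i = c"
    unfolding diagonal_def by blast
  then have "averaging \<omega> x = x $ j" for j
    by (simp add: averaging_def weights_sum flip: scaleR_sum_left)
  then show "deviation x = 0" by (simp add: deviation_def vec_eq_iff)
qed (auto simp: deviation_def vec_eq_iff diagonal_def)

lemma winner_deviation_diagonal: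
  assumes "z \<in> diagonal"
  shows "winner \<omega> (deviation x) z = 0"
proof -
  obtain c where c: "\<And>i. z $ i = c"
    using assms unfolding diagonal_def by blast
  have "winner \<omega> (deviation x) z = (\<Sum>i\<in>UNIV. \<omega> i *\<^sub>R (x $ i - averaging \<omega> x)) \<bullet> c"
    by (simp add: winner_def deviation_def c inner_sum_left)
  also have "(\<Sum>i\<in>UNIV. \<omega> i *\<^sub>R (x $ i - averaging \<omega> x)) = 0"
    by (simp add: scaleR_diff_right sum_subtractf weights_sum averaging_def flip: scaleR_sum_left)
  finally show ?thesis by simp
qed

text \<open>
  Pythagoras: the point \<open>p\<close> with all components equal to the average is the projection of \<open>x\<close>
  onto the diagonal, because \<open>x - p\<close> is orthogonal to it. Through this formula the distance
  inherits continuity from the norm, and its square inherits convexity, the deviation being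
  linear.
\<close>

lemma dist_diagonal_eq: "dist_diagonal \<omega> x = wnorm \<omega> (deviation x)"
proof -
  define p where "p = x - deviation x"
  have p: "p \<in> diagonal" by (simp add: p_def deviation_def diagonal_def)
  have "wnorm \<omega> (deviation x) \<le> wnorm \<omega> (x - z)" if "z \<in> diagonal" for z
  proof -
    have "p - z \<in> diagonal"
      using p that unfolding diagonal_def by (auto intro: arg_cong2[of _ _ _ _ "(-)"])
    then have "winner \<omega> (deviation x) (p - z) = 0"
      by (rule winner_deviation_diagonal)
    moreover have "x - z = deviation x + (p - z)" by (simp add: p_def)
    ultimately have "(wnorm \<omega> (x - z))\<^sup>2 = (wnorm \<omega> (deviation x))\<^sup>2 + (wnorm \<omega> (p - z))\<^sup>2"
      unfolding wnorm_power2
      by (simp only: winner_add_left winner_add_right winner_commute[of "p - z" "deviation x"])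
    then show ?thesis
      by (intro power2_le_imp_le[OF _ wnorm_nonneg]) simp
  qed
  moreover have "wnorm \<omega> (deviation x) = wnorm \<omega> (x - p)" by (simp add: p_def)
  ultimately show ?thesis
    unfolding dist_diagonal_def using p by (intro cInf_eq_minimum) auto
qed

lemma dist_diagonal_eq_0_iff: "dist_diagonal \<omega> x = 0 \<longleftrightarrow> x \<in> diagonal"
  by (simp add: dist_diagonal_eq wnorm_eq_0_iff deviation_eq_0_iff)

lemma tendsto_dist_diagonal:
  fixes a :: "'a::real_inner ^ 'm"
  assumes "(x \<longlongrightarrow> a) F"
  shows "((\<lambda>k. dist_diagonal \<omega> (x k)) \<longlongrightarrow> dist_diagonal \<omega> a) F"
proof -
  have "((\<lambda>k. deviation (x k)) \<longlongrightarrow> deviation a) F"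
    unfolding deviation_def
    by (rule vec_tendstoI) (auto intro!: tendsto_intros tendsto_averaging assms)
  then show ?thesis
    unfolding dist_diagonal_eq by (rule tendsto_wnorm)
qed

text \<open>
  First-order optimality of a proximal point. Comparing \<open>p\<close> with the points \<open>(1 - s) p + s y\<close>
  and dividing by \<open>s\<close> gives the inequality up to an error \<open>s b\<close>, which vanishes as \<open>s\<close> tends
  to \<open>0\<close>.
\<close>

lemma proximal_optimality:
  fixes g :: "'a::real_inner ^ 'm \<Rightarrow> real"
  assumes g: "convex_on K g" and p: "p \<in> K" and y: "y \<in> K"
    and min: "\<And>z. z \<in> K \<Longrightarrow> g p + (wnorm \<omega> (p - q))\<^sup>2 / 2 \<le> g z + (wnorm \<omega> (z - q))\<^sup>2 / 2"
  shows "g p + winner \<omega> (q - p) (y - p) \<le> g y"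
proof -
  define c where "c = g p + winner \<omega> (q - p) (y - p) - g y"
  define b where "b = (wnorm \<omega> (y - p))\<^sup>2 / 2"
  have "c \<le> s * b" if s: "0 < s" "s \<le> 1" for s
  proof -
    define z where "z = (1 - s) *\<^sub>R p + s *\<^sub>R y"
    have "z \<in> K"
      using convex_on_imp_convex[OF g] p y s unfolding z_def by (simp add: convexD)
    then have "g p + (wnorm \<omega> (p - q))\<^sup>2 / 2 \<le> g z + (wnorm \<omega> (z - q))\<^sup>2 / 2"
      by (rule min)
    moreover have "g z \<le> (1 - s) * g p + s * g y"
      using convex_onD[OF g, of s p y] p y s unfolding z_def by simp
    moreover have "(wnorm \<omega> (z - q))\<^sup>2 / 2
      = (wnorm \<omega> (p - q))\<^sup>2 / 2 - s * winner \<omega> (q - p) (y - p) + s * (s * b)"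
    proof -
      have z: "z - q = (p - q) + s *\<^sub>R (y - p)" by (simp add: z_def algebra_simps)
      have "winner \<omega> (y - p) (p - q) = - winner \<omega> (q - p) (y - p)"
        "winner \<omega> (p - q) (y - p) = - winner \<omega> (q - p) (y - p)"
        by (simp_all add: winner_simps winner_commute[of y] winner_commute[of p q])
      then show ?thesis
        unfolding z wnorm_power2 b_def winner_add_left winner_add_right
          winner_scaleR_left winner_scaleR_right
        by (simp add: field_simps)
    qed
    ultimately have "s * c \<le> s * (s * b)"
      unfolding c_def by (simp add: algebra_simps)
    then show ?thesis using s by simp
  qed
  then have "c \<le> inverse (real (Suc n)) * b" for n
    by (simp add: inverse_le_1_iff)
  moreover have "(\<lambda>n. inverse (real (Suc n)) * b) \<longlonglongrightarrow> 0"
    using tendsto_mult_left_zero[OF LIMSEQ_inverse_real_of_nat] .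
  ultimately have "c \<le> 0"
    by (intro LIMSEQ_le_const[of _ 0]) auto
  then show ?thesis by (simp add: c_def)
qed

end

text \<open>
  Tychonoff's theorem for the space of component functions, transported along the continuous map
  that assembles a vector from its components.
\<close>

lemma compact_set_product:
  fixes C :: "'m::finite \<Rightarrow> 'a::metric_space set"
  assumes "\<And>i. compact (C i)"
  shows "compact (set_product C)"
proof -
  have "compact (PiE UNIV C)"
    using assms by (simp add: compactin_PiE flip: compactin_euclidean_iff euclidean_product_topology)
  moreover have "continuous_on (PiE UNIV C) (\<lambda>g. \<chi> i. g i)"
    by (intro continuous_on_vec_lambda continuous_on_product_coordinates)
      (auto intro: continuous_on_subset[OF continuous_on_product_coordinates])
  ultimately have "compact ((\<lambda>g. \<chi> i. g i) ` PiE UNIV C)"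
    by (rule compact_continuous_image[rotated])
  moreover have "(\<lambda>g. \<chi> i. g i) ` PiE UNIV C = set_product C"
  proof (intro equalityI subsetI)
    fix x assume "x \<in> set_product C"
    then have "x = (\<chi> i. x $ i)" "($) x \<in> PiE UNIV C"
      by (auto simp: set_product_def)
    then show "x \<in> (\<lambda>g. \<chi> i. g i) ` PiE UNIV C" by blast
  qed (auto simp: set_product_def)
  ultimately show ?thesis by simp
qed

lemma convex_set_product:
  assumes "\<And>i. convex (C i)"
  shows "convex (set_product C)"
  using assms by (auto simp: convex_def set_product_def)

text \<open>
  For a function that is finite exactly on a nonempty set, subgradients exist only where the
  function is finite, and the subgradient inequality needs testing only there. This reduces
  extended-real inequalities to real ones.
\<close>

lemma subdifferential_extended_iff:
  assumes "S \<noteq> {}"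
  shows "u \<in> subdifferential ip (\<lambda>x. if x \<in> S then ereal (g x) else \<infinity>) x \<longleftrightarrow>
    x \<in> S \<and> (\<forall>y\<in>S. g x + ip u (y - x) \<le> g y)"
proof (cases "x \<in> S")
  case False
  obtain z where "z \<in> S" using assms by blast
  with False show ?thesis
    by (auto simp: subdifferential_def intro!: exI[of _ z])
next
  case True
  then show ?thesis by (simp add: subdifferential_def Ball_def if_distrib cong: if_cong)
qed


section \<open>The penalized problem\<close>

locale penalization = weighted_product \<omega>
  for \<omega> :: "'m::finite \<Rightarrow> real" +
  fixes f :: "'a::real_inner \<Rightarrow> real"
    and C :: "'m \<Rightarrow> 'a set"
  assumes f_continuous: "isCont f x"
    and C_compact: "compact (C i)"
    and C_common: "(\<Inter>i. C i) \<noteq> {}"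
begin

definition penalty_value :: "real \<Rightarrow> 'a ^ 'm \<Rightarrow> real"
  where "penalty_value l x = f (averaging \<omega> x) + l / 2 * (dist_diagonal \<omega> x)\<^sup>2"

lemma penalized_eq:
  "penalized \<omega> f C l x = (if x \<in> set_product C then ereal (penalty_value l x) else \<infinity>)"
  by (simp add: penalized_def penalty_value_def iota_def)

lemma constrained_eq:
  "constrained \<omega> f C x =
    (if x \<in> diagonal \<inter> set_product C then ereal (f (averaging \<omega> x)) else \<infinity>)"
  by (simp add: constrained_def iota_def)

lemma penalty_value_diagonal: "x \<in> diagonal \<Longrightarrow> penalty_value l x = f (averaging \<omega> x)"
  by (simp add: penalty_value_def dist_diagonal_eq_0_iff)

lemma penalized_le_constrained: "penalized \<omega> f C l x \<le> constrained \<omega> f C x"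
  by (simp add: penalized_eq constrained_eq penalty_value_diagonal)

lemma diagonal_set_product_nonempty: "diagonal \<inter> set_product C \<noteq> {}"
proof -
  obtain c where "\<And>i. c \<in> C i" using C_common by blast
  then have "(\<chi> i. c) \<in> diagonal \<inter> set_product C"
    by (simp add: diagonal_def set_product_def)
  then show ?thesis by blast
qed

lemma tendsto_f_averaging:
  "(x \<longlongrightarrow> a) F \<Longrightarrow> ((\<lambda>k. f (averaging \<omega> (x k))) \<longlongrightarrow> f (averaging \<omega> a)) F"
  using f_continuous by (rule isCont_tendsto_compose) (rule tendsto_averaging)

lemma continuous_penalty_value: "continuous_on S (penalty_value l)"
  unfolding penalty_value_def continuous_on_def
  by (auto intro!: tendsto_intros tendsto_f_averaging tendsto_dist_diagonal)

lemma convex_penalty_value: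
  assumes "convex S" and f: "convex_on UNIV f" and l: "0 \<le> l"
  shows "convex_on S (penalty_value l)"
proof (rule convex_onI[OF _ \<open>convex S\<close>])
  fix s :: real and x y :: "'a ^ 'm"
  assume s: "0 < s" "s < 1"
  have "f (averaging \<omega> ((1 - s) *\<^sub>R x + s *\<^sub>R y))
    \<le> (1 - s) * f (averaging \<omega> x) + s * f (averaging \<omega> y)"
    unfolding averaging_combination using convex_onD[OF f] s by simp
  moreover have "(dist_diagonal \<omega> ((1 - s) *\<^sub>R x + s *\<^sub>R y))\<^sup>2
    \<le> (1 - s) * (dist_diagonal \<omega> x)\<^sup>2 + s * (dist_diagonal \<omega> y)\<^sup>2"
    unfolding dist_diagonal_eq deviation_combination using s by (intro wnorm_power2_convex) auto
  then have "l / 2 * (dist_diagonal \<omega> ((1 - s) *\<^sub>R x + s *\<^sub>R y))\<^sup>2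
    \<le> l / 2 * ((1 - s) * (dist_diagonal \<omega> x)\<^sup>2 + s * (dist_diagonal \<omega> y)\<^sup>2)"
    using l by (intro mult_left_mono) auto
  ultimately have "penalty_value l ((1 - s) *\<^sub>R x + s *\<^sub>R y)
    \<le> (1 - s) * f (averaging \<omega> x) + s * f (averaging \<omega> y)
      + l / 2 * ((1 - s) * (dist_diagonal \<omega> x)\<^sup>2 + s * (dist_diagonal \<omega> y)\<^sup>2)"
    unfolding penalty_value_def by (rule add_mono)
  also have "\<dots> = (1 - s) * penalty_value l x + s * penalty_value l y"
    by (simp add: penalty_value_def ring_distribs mult.left_commute)
  finally show "penalty_value l ((1 - s) *\<^sub>R x + s *\<^sub>R y)
    \<le> (1 - s) * penalty_value l x + s * penalty_value l y" .
qed

text \<open>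
  The bound rewrites to \<open>dist\<^sup>2 \<le> 2 (b k - f) / l k\<close> with a bounded numerator, so in the limit the
  distance to the diagonal is \<open>0\<close>. Dropping the nonnegative penalty term instead leaves
  \<open>f \<le> b k\<close>, which passes to the limit by continuity.
\<close>

lemma limit_of_bounded_penalties:
  assumes l: "filterlim l at_top sequentially"
    and x: "x \<longlonglongrightarrow> a" "\<And>k. x k \<in> set_product C"
    and le: "\<And>k. penalty_value (l k) (x k) \<le> b k"
    and b: "b \<longlonglongrightarrow> \<beta>"
  shows "a \<in> diagonal \<inter> set_product C" and "f (averaging \<omega> a) \<le> \<beta>"
proof -
  let ?f = "\<lambda>k. f (averaging \<omega> (x k))" and ?d = "\<lambda>k. (dist_diagonal \<omega> (x k))\<^sup>2"
  have f_lim: "?f \<longlonglongrightarrow> f (averaging \<omega> a)"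
    using x(1) by (rule tendsto_f_averaging)
  have d_lim: "?d \<longlonglongrightarrow> (dist_diagonal \<omega> a)\<^sup>2"
    by (intro tendsto_intros tendsto_dist_diagonal x(1))
  have "(\<lambda>k. 2 * (b k - ?f k) * inverse (l k)) \<longlonglongrightarrow> 2 * (\<beta> - f (averaging \<omega> a)) * 0"
    by (intro tendsto_intros b f_lim filterlim_compose[OF tendsto_inverse_0_at_top l] filterlim_ident)
  then have "(dist_diagonal \<omega> a)\<^sup>2 \<le> 2 * (\<beta> - f (averaging \<omega> a)) * 0"
  proof (rule tendsto_le[OF sequentially_bot _ d_lim])
    have "\<forall>\<^sub>F k in sequentially. 0 < l k"
      using l by (simp add: filterlim_at_top_dense)
    then show "\<forall>\<^sub>F k in sequentially. ?d k \<le> 2 * (b k - ?f k) * inverse (l k)"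
    proof (rule eventually_mono)
      fix k assume "0 < l k"
      then show "?d k \<le> 2 * (b k - ?f k) * inverse (l k)"
        using le[of k] by (simp add: penalty_value_def field_simps)
    qed
  qed
  then have "a \<in> diagonal"
    by (simp add: dist_diagonal_eq_0_iff)
  moreover have "a \<in> set_product C"
    using compact_imp_closed[OF compact_set_product[of C]] C_compact x
    by (auto intro: closed_sequentially)
  ultimately show "a \<in> diagonal \<inter> set_product C" by simp
  have "\<forall>\<^sub>F k in sequentially. 0 \<le> l k"
    using l by (simp add: filterlim_at_top)
  then have "\<forall>\<^sub>F k in sequentially. ?f k \<le> b k"
  proof (rule eventually_mono)
    fix k assume "0 \<le> l k"
    then have "0 \<le> l k / 2 * ?d k" by simp
    then show "?f k \<le> b k" using le[of k] by (simp add: penalty_value_def)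
  qed
  then show "f (averaging \<omega> a) \<le> \<beta>"
    by (rule tendsto_le[OF sequentially_bot b f_lim])
qed

text \<open>
  The penalized values are constant in the parameter on the diagonal and outside the product of
  the sets; elsewhere the penalty grows without bound.
\<close>

lemma penalized_tendsto_constrained:
  assumes l: "filterlim l at_top sequentially"
  shows "(\<lambda>t. penalized \<omega> f C (l t) x) \<longlonglongrightarrow> constrained \<omega> f C x"
proof (cases "x \<in> set_product C - diagonal")
  case True
  then have "0 < (dist_diagonal \<omega> x)\<^sup>2 / 2"
    by (simp add: dist_diagonal_eq_0_iff)
  then have "filterlim (\<lambda>t. (dist_diagonal \<omega> x)\<^sup>2 / 2 * l t) at_top sequentially"
    by (intro filterlim_tendsto_pos_mult_at_top[OF tendsto_const _ l])
  then have "filterlim (\<lambda>t. penalty_value (l t) x) at_top sequentially"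
    unfolding penalty_value_def
    by (intro filterlim_tendsto_add_at_top[OF tendsto_const]) (simp add: mult.commute)
  then show ?thesis
    using True by (simp add: penalized_eq constrained_eq tendsto_PInfty_eq_at_top)
qed (auto simp: penalized_eq constrained_eq penalty_value_diagonal)

lemma penalized_epi_converges:
  assumes l: "filterlim l at_top sequentially"
  shows "epi_converges (wnorm \<omega>) (\<lambda>t. penalized \<omega> f C (l t)) (constrained \<omega> f C)"
  unfolding epi_converges_def
proof (rule PK_convergesI[OF prod_norm_nonneg])
  fix p assume "p \<in> epi (constrained \<omega> f C)"
  then have "p \<in> epi (penalized \<omega> f C (l t))" for t
    using penalized_le_constrained[of "l t" "fst p"] by (auto simp: epi_def intro: order_trans)
  then show "\<exists>q. (\<forall>\<^sub>F t in sequentially. q t \<in> epi (penalized \<omega> f C (l t))) \<and>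
      (\<lambda>t. prod_norm (wnorm \<omega>) norm (p - q t)) \<longlonglongrightarrow> 0"
    by (intro exI[of _ "\<lambda>_. p"]) (simp add: prod_norm_def wnorm_def winner_def)
next
  fix p r q
  assume r: "filterlim r at_top sequentially"
    and q: "\<And>k. q k \<in> epi (penalized \<omega> f C (l (r k)))"
    and lim: "(\<lambda>k. prod_norm (wnorm \<omega>) norm (p - q k)) \<longlonglongrightarrow> 0"
  have "(\<lambda>k. fst (q k)) \<longlonglongrightarrow> fst p"
    using tendsto_prod_normD(1)[OF lim] by (simp add: tendsto_iff_wnorm)
  moreover have snd_lim: "(\<lambda>k. snd (q k)) \<longlonglongrightarrow> snd p"
    using tendsto_prod_normD(2)[OF lim] tendsto_dist_iff[of "\<lambda>k. snd (q k)" "snd p"]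
    by (simp add: dist_real_def abs_minus_commute)
  moreover have "fst (q k) \<in> set_product C" "penalty_value (l (r k)) (fst (q k)) \<le> snd (q k)" for k
    using q[of k] by (auto simp: epi_def penalized_eq split: if_splits)
  ultimately have "fst p \<in> diagonal \<inter> set_product C" "f (averaging \<omega> (fst p)) \<le> snd p"
    by - (rule limit_of_bounded_penalties[OF filterlim_compose[OF l r]], assumption+)+
  then show "p \<in> epi (constrained \<omega> f C)"
    by (simp add: epi_def constrained_eq case_prod_beta)
qed

lemma subgradient_constrained_iff:
  "u \<in> subdifferential (winner \<omega>) (constrained \<omega> f C) x \<longleftrightarrow>
    x \<in> diagonal \<inter> set_product C \<and>
    (\<forall>y\<in>diagonal \<inter> set_product C. f (averaging \<omega> x) + winner \<omega> u (y - x) \<le> f (averaging \<omega> y))"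
  unfolding constrained_eq[abs_def]
  by (rule subdifferential_extended_iff[OF diagonal_set_product_nonempty])

lemma subgradient_penalized_iff:
  "u \<in> subdifferential (winner \<omega>) (penalized \<omega> f C l) x \<longleftrightarrow>
    x \<in> set_product C \<and>
    (\<forall>y\<in>set_product C. penalty_value l x + winner \<omega> u (y - x) \<le> penalty_value l y)"
  unfolding penalized_eq[abs_def]
  using diagonal_set_product_nonempty by (intro subdifferential_extended_iff) blast

text \<open>
  At a test point \<open>y\<close> of the diagonal the penalized value does not depend on the parameter. The
  subgradient inequality there thus bounds the penalized values at \<open>x k\<close> by a convergent sequence.
\<close>

lemma limit_of_subgradients:
  assumes l: "filterlim l at_top sequentially"
    and u_sub: "\<And>k. u k \<in> subdifferential (winner \<omega>) (penalized \<omega> f C (l k)) (x k)"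
    and x: "x \<longlonglongrightarrow> a" and u: "u \<longlonglongrightarrow> v"
  shows "v \<in> subdifferential (winner \<omega>) (constrained \<omega> f C) a"
proof -
  have lim: "a \<in> diagonal \<inter> set_product C"
      "f (averaging \<omega> a) \<le> f (averaging \<omega> y) - winner \<omega> v (y - a)"
    if y: "y \<in> diagonal \<inter> set_product C" for y
  proof -
    have "x k \<in> set_product C" for k
      using u_sub[of k] by (simp add: subgradient_penalized_iff)
    moreover have "penalty_value (l k) (x k) \<le> f (averaging \<omega> y) - winner \<omega> (u k) (y - x k)" for k
      using u_sub[of k] y penalty_value_diagonal[of y "l k"]
      by (force simp: subgradient_penalized_iff)
    moreover have "(\<lambda>k. f (averaging \<omega> y) - winner \<omega> (u k) (y - x k))
      \<longlonglongrightarrow> f (averaging \<omega> y) - winner \<omega> v (y - a)"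
      by (intro tendsto_intros tendsto_winner x u)
    ultimately show "a \<in> diagonal \<inter> set_product C"
      "f (averaging \<omega> a) \<le> f (averaging \<omega> y) - winner \<omega> v (y - a)"
      by (rule limit_of_bounded_penalties[OF l x])+
  qed
  then show ?thesis
    using diagonal_set_product_nonempty by (fastforce simp: subgradient_constrained_iff)
qed

lemma exists_proximal_point:
  "\<exists>p\<in>set_product C. \<forall>z\<in>set_product C.
    penalty_value l p + (wnorm \<omega> (p - q))\<^sup>2 / 2
      \<le> penalty_value l z + (wnorm \<omega> (z - q))\<^sup>2 / 2"
proof -
  have "continuous_on (set_product C) (\<lambda>z. penalty_value l z + (wnorm \<omega> (z - q))\<^sup>2 / 2)"
    by (intro continuous_intros continuous_penalty_value)
      (auto simp: continuous_on_def intro!: tendsto_wnorm tendsto_intros)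
  then show ?thesis
    using continuous_attains_inf[OF compact_set_product[of C]] C_compact
      diagonal_set_product_nonempty by blast
qed

text \<open>
  By compactness it is enough that \<open>a\<close> is the only cluster point \<open>b\<close>. Adding the subgradient
  inequalities of \<open>u\<close> at \<open>a\<close> and of \<open>a + u - b\<close> at \<open>b\<close>, each tested at the other point, leaves
  the squared norm of \<open>a - b\<close> on one side and \<open>0\<close> on the other.
\<close>

lemma proximal_points_tendsto:
  assumes l: "filterlim l at_top sequentially"
    and u: "u \<in> subdifferential (winner \<omega>) (constrained \<omega> f C) a"
    and p: "\<And>t. p t \<in> set_product C"
    and p_sub: "\<forall>\<^sub>F t in sequentially.
      a + u - p t \<in> subdifferential (winner \<omega>) (penalized \<omega> f C (l t)) (p t)"
  shows "p \<longlonglongrightarrow> a"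
proof (rule ccontr)
  assume "\<not> p \<longlonglongrightarrow> a"
  then obtain e where e: "0 < e" "\<not> (\<forall>\<^sub>F t in sequentially. dist (p t) a < e)"
    unfolding tendsto_iff by blast
  have "\<exists>\<^sub>F t in sequentially. e \<le> dist (p t) a \<and>
      a + u - p t \<in> subdifferential (winner \<omega>) (penalized \<omega> f C (l t)) (p t)"
    using e(2) by (intro frequently_eventually_frequently[OF _ p_sub])
      (simp add: not_eventually not_less)
  then obtain r where r: "\<And>k. k \<le> r k" "\<And>k. e \<le> dist (p (r k)) a"
    "\<And>k. a + u - p (r k) \<in> subdifferential (winner \<omega>) (penalized \<omega> f C (l (r k))) (p (r k))"
    unfolding frequently_sequentially by metis
  have "seq_compact (set_product C)"
    using compact_set_product[of C] C_compact by (simp add: compact_eq_seq_compact_metric)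
  then obtain b s where s: "strict_mono s" "((p \<circ> r) \<circ> s) \<longlonglongrightarrow> b"
    by (rule seq_compactE[of _ "p \<circ> r"]) (simp add: p)
  from s(2) have ps_lim: "(\<lambda>k. p (r (s k))) \<longlonglongrightarrow> b"
    by (simp add: o_def)
  have "filterlim r at_top sequentially"
    using r(1) by (intro filterlim_at_top_mono[OF filterlim_ident]) auto
  then have ls: "filterlim (\<lambda>k. l (r (s k))) at_top sequentially"
    by (intro filterlim_compose[OF l] filterlim_compose[OF _ filterlim_subseq[OF s(1)]])
  have v: "a + u - b \<in> subdifferential (winner \<omega>) (constrained \<omega> f C) b"
    by (rule limit_of_subgradients[OF ls r(3) ps_lim]) (intro tendsto_intros ps_lim)
  have "f (averaging \<omega> b) + winner \<omega> (a + u - b) (a - b) \<le> f (averaging \<omega> a)"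
    "f (averaging \<omega> a) + winner \<omega> u (b - a) \<le> f (averaging \<omega> b)"
    using u v by (auto simp: subgradient_constrained_iff)
  then have "(wnorm \<omega> (a - b))\<^sup>2 \<le> 0"
    unfolding wnorm_power2 by (simp add: winner_simps)
  then have "a = b" by (simp add: wnorm_eq_0_iff)
  have "(\<lambda>k. dist (p (r (s k))) a) \<longlonglongrightarrow> dist b a"
    by (intro tendsto_intros ps_lim)
  then have "e \<le> dist b a"
    by (rule LIMSEQ_le_const) (use r(2) in auto)
  with e(1) \<open>a = b\<close> show False by simp
qed

text \<open>
  Minty's parametrization drives the inner limit: the point \<open>(a, u)\<close> of the limit graph is
  approximated by the points of the penalized graphs whose two components have the same sum
  \<open>a + u\<close>.
\<close>

lemma subdifferential_graph_converges:
  assumes l: "filterlim l at_top sequentially"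
    and f_convex: "convex_on UNIV f" and C_convex: "\<And>i. convex (C i)"
  shows "graph_converges (wnorm \<omega>)
    (\<lambda>t. subdifferential (winner \<omega>) (penalized \<omega> f C (l t)))
    (subdifferential (winner \<omega>) (constrained \<omega> f C))"
  unfolding graph_converges_def
proof (rule PK_convergesI[OF prod_norm_nonneg])
  fix w assume "w \<in> gra (subdifferential (winner \<omega>) (constrained \<omega> f C))"
  then obtain a u where w: "w = (a, u)"
    and u: "u \<in> subdifferential (winner \<omega>) (constrained \<omega> f C) a"
    by (auto simp: gra_def)
  have "\<forall>t. \<exists>p. p \<in> set_product C \<and> (\<forall>z\<in>set_product C.
      penalty_value (l t) p + (wnorm \<omega> (p - (a + u)))\<^sup>2 / 2
        \<le> penalty_value (l t) z + (wnorm \<omega> (z - (a + u)))\<^sup>2 / 2)"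
    using exists_proximal_point by blast
  from choice[OF this] obtain p where p: "\<And>t. p t \<in> set_product C"
    and min: "\<And>t z. z \<in> set_product C \<Longrightarrow>
      penalty_value (l t) (p t) + (wnorm \<omega> (p t - (a + u)))\<^sup>2 / 2
        \<le> penalty_value (l t) z + (wnorm \<omega> (z - (a + u)))\<^sup>2 / 2"
    by blast
  have "\<forall>\<^sub>F t in sequentially. 0 \<le> l t"
    using l by (simp add: filterlim_at_top)
  then have p_sub: "\<forall>\<^sub>F t in sequentially.
      a + u - p t \<in> subdifferential (winner \<omega>) (penalized \<omega> f C (l t)) (p t)"
  proof (rule eventually_mono)
    fix t assume "0 \<le> l t"
    then have "convex_on (set_product C) (penalty_value (l t))"
      by (intro convex_penalty_value convex_set_product C_convex f_convex)
    then show "a + u - p t \<in> subdifferential (winner \<omega>) (penalized \<omega> f C (l t)) (p t)"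
      using p min by (auto simp: subgradient_penalized_iff intro: proximal_optimality)
  qed
  have p_lim: "p \<longlonglongrightarrow> a"
    by (rule proximal_points_tendsto[OF l u p p_sub])
  then have u_lim: "(\<lambda>t. a + u - p t) \<longlonglongrightarrow> a + u - a"
    by (intro tendsto_intros)
  show "\<exists>q. (\<forall>\<^sub>F t in sequentially.
        q t \<in> gra (subdifferential (winner \<omega>) (penalized \<omega> f C (l t)))) \<and>
      (\<lambda>t. prod_norm (wnorm \<omega>) (wnorm \<omega>) (w - q t)) \<longlonglongrightarrow> 0"
  proof (intro exI[of _ "\<lambda>t. (p t, a + u - p t)"] conjI tendsto_prod_normI)
    show "\<forall>\<^sub>F t in sequentially. (p t, a + u - p t)
        \<in> gra (subdifferential (winner \<omega>) (penalized \<omega> f C (l t)))"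
      using p_sub by (simp add: gra_def)
    show "(\<lambda>t. wnorm \<omega> (fst (w - (p t, a + u - p t)))) \<longlonglongrightarrow> 0"
      using p_lim by (simp add: w tendsto_iff_wnorm)
    show "(\<lambda>t. wnorm \<omega> (snd (w - (p t, a + u - p t)))) \<longlonglongrightarrow> 0"
      using u_lim unfolding tendsto_iff_wnorm by (simp add: w)
  qed
next
  fix w r q
  assume r: "filterlim r at_top sequentially"
    and q: "\<And>k. q k \<in> gra (subdifferential (winner \<omega>) (penalized \<omega> f C (l (r k))))"
    and lim: "(\<lambda>k. prod_norm (wnorm \<omega>) (wnorm \<omega>) (w - q k)) \<longlonglongrightarrow> 0"
  have "snd w \<in> subdifferential (winner \<omega>) (constrained \<omega> f C) (fst w)"
  proof (rule limit_of_subgradients[OF filterlim_compose[OF l r]])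
    show "snd (q k) \<in> subdifferential (winner \<omega>) (penalized \<omega> f C (l (r k))) (fst (q k))" for k
      using q[of k] by (auto simp: gra_def)
    show "(\<lambda>k. fst (q k)) \<longlonglongrightarrow> fst w" "(\<lambda>k. snd (q k)) \<longlonglongrightarrow> snd w"
      using tendsto_prod_normD[OF lim] by (simp_all add: tendsto_iff_wnorm)
  qed
  then show "w \<in> gra (subdifferential (winner \<omega>) (constrained \<omega> f C))"
    by (auto simp: gra_def split: prod.splits)
qed

end

theorem proposition2p14:
  fixes f :: "'a::{real_inner, complete_space} \<Rightarrow> real"
    and L\<^sub>f :: real
    and \<omega> :: "'m::finite \<Rightarrow> real"
    and C :: "'m \<Rightarrow> 'a set"
    and lam :: "nat \<Rightarrow> real"
  assumes "\<And>i. 0 < \<omega> i" and "\<And>i. \<omega> i \<le> 1" and "(\<Sum>i\<in>UNIV. \<omega> i) = 1"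
    and "\<And>x. f differentiable (at x)" and "L\<^sub>f > 0" and "L_smooth L\<^sub>f f"
    and "\<And>i. C i \<noteq> {}" and "\<And>i. compact (C i)" and "\<And>i. convex (C i)"
    and "(\<Inter>i. C i) \<noteq> {}"
    and "filterlim lam at_top sequentially"
  shows "(\<forall>x. (\<lambda>t. penalized \<omega> f C (lam t) x) \<longlonglongrightarrow> constrained \<omega> f C x) \<and>
    (finite_dim TYPE('a) \<longrightarrow>
      epi_converges (wnorm \<omega>) (\<lambda>t. penalized \<omega> f C (lam t)) (constrained \<omega> f C)) \<and>
    (finite_dim TYPE('a) \<and> convex_on UNIV f \<longrightarrow>
      graph_converges (wnorm \<omega>)
        (\<lambda>t. subdifferential (winner \<omega>) (penalized \<omega> f C (lam t)))
        (subdifferential (winner \<omega>) (constrained \<omega> f C)))"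
proof -
  interpret penalization \<omega> f C
    using assms by unfold_locales (auto intro: differentiable_imp_continuous_within)
  show ?thesis
    using assms(9,11)
    by (intro conjI allI impI penalized_tendsto_constrained penalized_epi_converges
        subdifferential_graph_converges) auto
qed

end
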